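(* Let $k\in\mathbb{N}$, let $\mathcal{S}=\{p_1,\dots,p_k\}$ be a set of $k$ distinct primes and $\mathcal{A}_{\mathcal{S}}=\{\prod_{i=1}^kp_i^{a_i}:a_1,\dots,a_k\in\mathbb{Z}_{\ge0}\}$. Let $\mathcal{A}=(q_n)_{n\in\mathbb{N}}\subseteq\mathcal{A}_{\mathcal{S}}$ be an increasing sequence of natural numbers. Then there exists a constant $C$, depending only on $k$, such that for every integer $n\ge2$, $$\sum_{m=1}^{n-1}\frac{(q_m,q_n)}{q_n}\le C,$$ where $(q_m,q_n)$ denotes the greatest common divisor. *)

theory Defs
  imports Complex_Main "HOL-Computational_Algebra.Primes"
begin

definition prime_products :: "nat set \<Rightarrow> nat set" where
  "prime_products S = {\<Prod>p\<in>S. p ^ a p | a :: nat \<Rightarrow> nat. True}"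

end

theory Submission
  imports Defs "HOL-Library.FuncSet"
begin

text \<open>
  For \<open>x \<le> N\<close> in \<open>prime_products S\<close> put \<open>g = gcd x N\<close>, \<open>d = N / g\<close> and \<open>e = x / g\<close>. Since \<open>e \<le> d\<close>,
  the summand \<open>g / N = 1 / d\<close> is at most \<open>1 / (sqrt d * sqrt e)\<close>. The pair \<open>(d, e)\<close> lies in
  \<open>prime_products S \<times> prime_products S\<close> and determines \<open>x\<close>, so the sum is bounded by the square of
  the Euler product \<open>\<Prod>p\<in>S. 1 / (1 - 1 / sqrt p)\<close>, whose factors are largest for \<open>p = 2\<close>.
\<close>

text \<open>In this form, membership passes to divisors at once. For the converse, the
  multiplicities in \<open>x\<close> serve as exponents; they vanish at those primes of
  \<open>S\<close> that do not divide \<open>x\<close>.\<close>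

lemma prime_products_iff:
  assumes "finite S" "\<forall>p\<in>S. prime p"
  shows "x \<in> prime_products S \<longleftrightarrow> x > 0 \<and> prime_factors x \<subseteq> S"
proof
  assume "x \<in> prime_products S"
  then obtain a where x: "x = (\<Prod>p\<in>S. p ^ a p)"
    by (auto simp: prime_products_def)
  have "x > 0"
    unfolding x using assms(2) by (auto intro!: prod_pos simp: prime_gt_0_nat)
  moreover have "r \<in> S" if "r \<in> prime_factors x" for r
  proof -
    have "prime r"
      using that by (rule in_prime_factors_imp_prime)
    moreover have "r dvd (\<Prod>p\<in>S. p ^ a p)"
      using in_prime_factors_imp_dvd[OF that] unfolding x .
    ultimately have "\<exists>p\<in>S. r dvd p ^ a p"
      using prime_dvd_prod_iff[OF assms(1), of r "\<lambda>p. p ^ a p"] by simp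
    then obtain p where p: "p \<in> S" "r dvd p ^ a p"
      by (rule bexE)
    have "r dvd p"
      using \<open>prime r\<close> p(2) by (rule prime_dvd_power)
    then have "r = p"
      using primes_dvd_imp_eq[OF \<open>prime r\<close>] assms(2) p(1) by blast
    then show ?thesis
      using p(1) by simp
  qed
  ultimately show "x > 0 \<and> prime_factors x \<subseteq> S"
    by blast
next
  assume x: "x > 0 \<and> prime_factors x \<subseteq> S"
  have "x = (\<Prod>p\<in>prime_factors x. p ^ multiplicity p x)"
    using x prime_factorization_nat by blast
  also have "\<dots> = (\<Prod>p\<in>S. p ^ multiplicity p x)"
    using assms x by (intro prod.mono_neutral_left)
      (auto simp: prime_factors_multiplicity)
  finally show "x \<in> prime_products S"
    by (auto simp: prime_products_def)
qed

lemma prime_products_dvd: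
  assumes "finite S" "\<forall>p\<in>S. prime p" "x \<in> prime_products S" "y dvd x"
  shows "y \<in> prime_products S"
proof -
  have "x > 0" "prime_factors x \<subseteq> S"
    using assms(3) prime_products_iff[OF assms(1,2)] by auto
  then show ?thesis
    using assms(4) dvd_prime_factors[of x y] dvd_pos_nat[of x y]
    unfolding prime_products_iff[OF assms(1,2)] by blast
qed

text \<open>Comparison with the full geometric series at \<open>p = 2\<close> makes the bound
  uniform in \<open>p\<close>, so the final constant sees only the size of \<open>S\<close>.\<close>

lemma sum_inverse_sqrt_powers_le:
  assumes "p \<ge> 2"
  shows "(\<Sum>i\<le>M. (1 / sqrt (real p)) ^ i) \<le> 1 / (1 - 1 / sqrt 2)"
proof -
  have "1 / sqrt (real p) \<le> 1 / sqrt 2"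
    using assms by (intro divide_left_mono) auto
  then have "(\<Sum>i\<le>M. (1 / sqrt (real p)) ^ i) \<le> (\<Sum>i\<le>M. (1 / sqrt 2) ^ i)"
    by (intro sum_mono power_mono) auto
  also have "\<dots> \<le> (\<Sum>i. (1 / sqrt 2) ^ i)"
    by (intro sum_le_suminf summable_geometric) auto
  also have "\<dots> = 1 / (1 - 1 / sqrt 2)"
    by (intro suminf_geometric) auto
  finally show ?thesis .
qed

text \<open>A finite Euler product: \<open>T\<close> is covered by the products with all exponents
  at most \<open>M\<close>, and the sum over these exponent vectors factors over the primes of
  \<open>S\<close>.\<close>

lemma sum_inverse_sqrt_prime_products_le:
  assumes S: "finite S" "\<forall>p\<in>S. prime p" and T: "finite T" "T \<subseteq> prime_products S"
  shows "(\<Sum>t\<in>T. 1 / sqrt (real t)) \<le> (1 / (1 - 1 / sqrt 2)) ^ card S"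
proof -
  define M where "M = Max T"
  define f :: "(nat \<Rightarrow> nat) \<Rightarrow> nat" where "f = (\<lambda>a. \<Prod>p\<in>S. p ^ a p)"
  define F where "F = (\<Pi>\<^sub>E p\<in>S. {..M})"
  have "finite F"
    using S(1) by (auto simp: F_def intro!: finite_PiE)
  have "T \<subseteq> f ` F"
  proof
    fix t assume t: "t \<in> T"
    then obtain a where a: "t = (\<Prod>p\<in>S. p ^ a p)"
      using T(2) by (auto simp: prime_products_def)
    have "t > 0"
      using t T(2) prime_products_iff[OF S] by auto
    \<comment> \<open>The largest element of \<open>T\<close> also bounds every exponent, since
      \<open>a p < p ^ a p \<le> t\<close>.\<close>
    have "a p \<le> M" if p: "p \<in> S" for p
    proof -
      have "a p < p ^ a p"
        using S(2) p prime_gt_1_nat by (intro power_gt_expt) auto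
      also have "p ^ a p dvd t"
        unfolding a using S(1) p by (rule dvd_prodI)
      then have "p ^ a p \<le> t"
        using \<open>t > 0\<close> by (rule dvd_imp_le)
      also have "t \<le> M"
        using t T(1) by (simp add: M_def)
      finally show ?thesis by simp
    qed
    then have "restrict a S \<in> F"
      by (auto simp: F_def)
    moreover have "f (restrict a S) = t"
      by (simp add: f_def a)
    ultimately show "t \<in> f ` F"
      by blast
  qed
  then have "(\<Sum>t\<in>T. 1 / sqrt (real t)) \<le> (\<Sum>t\<in>f ` F. 1 / sqrt (real t))"
    using \<open>finite F\<close> by (intro sum_mono2) auto
  \<comment> \<open>Each value of \<open>f\<close> is counted at least once on the right, and all
    terms are nonnegative.\<close>
  also have "\<dots> \<le> (\<Sum>a\<in>F. 1 / sqrt (real (f a)))"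
    using sum_image_le[OF \<open>finite F\<close>, of "\<lambda>t. 1 / sqrt (real t)" f] by (simp add: o_def)
  also have "\<dots> = (\<Sum>a\<in>F. \<Prod>p\<in>S. (1 / sqrt (real p)) ^ a p)"
  proof (rule sum.cong)
    fix a
    have "sqrt (\<Prod>p\<in>S. real p ^ a p) = (\<Prod>p\<in>S. sqrt (real p) ^ a p)"
      using S(1) by (induction S rule: finite_induct) (simp_all add: real_sqrt_mult real_sqrt_power)
    then show "1 / sqrt (real (f a)) = (\<Prod>p\<in>S. (1 / sqrt (real p)) ^ a p)"
      by (simp add: f_def power_one_over prod_dividef)
  qed simp
  also have "\<dots> = (\<Prod>p\<in>S. \<Sum>i\<le>M. (1 / sqrt (real p)) ^ i)"
    unfolding F_def using S(1) by (intro prod_sum_PiE[symmetric]) auto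
  also have "\<dots> \<le> (\<Prod>p\<in>S. 1 / (1 - 1 / sqrt 2))"
    using S(2) by (intro prod_mono conjI sum_inverse_sqrt_powers_le sum_nonneg)
      (auto simp: prime_ge_2_nat)
  finally show ?thesis by simp
qed

lemma sum_gcd_prime_products_le:
  assumes S: "finite S" "\<forall>p\<in>S. prime p"
    and X: "X \<subseteq> prime_products S" "\<And>x. x \<in> X \<Longrightarrow> x \<le> N" and N: "N \<in> prime_products S"
  shows "(\<Sum>x\<in>X. real (gcd x N) / real N) \<le> ((1 / (1 - 1 / sqrt 2)) ^ card S)\<^sup>2"
proof -
  define d where "d x = N div gcd x N" for x
  define e where "e x = x div gcd x N" for x
  define w where "w t = 1 / sqrt (real t)" for t :: nat
  have "finite X"
    using X(2) by (auto intro: finite_subset[of X "{..N}"])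
  have "N > 0"
    using N prime_products_iff[OF S] by blast
  have pos: "x > 0" if "x \<in> X" for x
    using that X(1) prime_products_iff[OF S] by blast
  have term_le: "real (gcd x N) / real N \<le> w (d x) * w (e x)" if "x \<in> X" for x
  proof -
    have "gcd x N > 0"
      using \<open>N > 0\<close> by simp
    have N_eq: "N = d x * gcd x N" and x_eq: "x = e x * gcd x N"
      by (simp_all add: d_def e_def)
    have "d x > 0" "e x > 0"
      using N_eq x_eq \<open>N > 0\<close> pos[OF that] by (metis mult_is_0 neq0_conv)+
    have "e x \<le> d x"
      unfolding d_def e_def using X(2)[OF that] by (rule div_le_mono)
    have "real N = real (d x) * real (gcd x N)"
      by (subst N_eq) (rule of_nat_mult)
    then have "real (gcd x N) / real N = 1 / real (d x)"
      using \<open>gcd x N > 0\<close> \<open>d x > 0\<close> by simp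
    also have "\<dots> = 1 / (sqrt (real (d x)) * sqrt (real (d x)))"
      by simp
    \<comment> \<open>Trading one factor \<open>sqrt (d x)\<close> for the smaller
      \<open>sqrt (e x)\<close> puts a weight on \<open>e x\<close> too, so that the sum over all
      pairs will split into two factors.\<close>
    also have "\<dots> \<le> 1 / (sqrt (real (d x)) * sqrt (real (e x)))"
      using \<open>d x > 0\<close> \<open>e x > 0\<close> \<open>e x \<le> d x\<close> by (intro divide_left_mono mult_left_mono) auto
    finally show ?thesis
      by (simp add: w_def)
  qed
  have inj: "inj_on (\<lambda>x. (d x, e x)) X"
  proof (rule inj_onI)
    fix x y assume "(d x, e x) = (d y, e y)"
    then have eq: "d x = d y" "e x = e y"
      by auto
    \<comment> \<open>Both sides equal \<open>N\<close>. Hence \<open>d\<close> determines the gcd,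
      and multiplying it by \<open>e\<close> recovers the element.\<close>
    have "d x * gcd x N = d y * gcd y N"
      by (simp add: d_def)
    moreover have "d x \<noteq> 0"
      using \<open>N > 0\<close> by (auto simp: d_def dvd_div_eq_0_iff)
    ultimately have "gcd x N = gcd y N"
      by (simp add: eq)
    then show "x = y"
      using eq(2) by (metis e_def gcd_dvd1 dvd_div_mult_self)
  qed
  \<comment> \<open>\<open>d x\<close> divides \<open>N\<close>, and likewise below
    \<open>e x\<close> divides \<open>x\<close>.\<close>
  have "d ` X \<subseteq> prime_products S"
    unfolding d_def using prime_products_dvd[OF S N]
    by (auto simp: div_dvd_iff_mult \<open>N > 0\<close>)
  then have D: "sum w (d ` X) \<le> (1 / (1 - 1 / sqrt 2)) ^ card S"
    unfolding w_def using \<open>finite X\<close> by (intro sum_inverse_sqrt_prime_products_le S) auto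
  have "e ` X \<subseteq> prime_products S"
    unfolding e_def using prime_products_dvd[OF S] X(1) pos
    by (fastforce simp: div_dvd_iff_mult)
  then have E: "sum w (e ` X) \<le> (1 / (1 - 1 / sqrt 2)) ^ card S"
    unfolding w_def using \<open>finite X\<close> by (intro sum_inverse_sqrt_prime_products_le S) auto
  have w_nonneg: "w t \<ge> 0" for t
    by (simp add: w_def)
  have "(\<Sum>x\<in>X. real (gcd x N) / real N) \<le> (\<Sum>x\<in>X. w (d x) * w (e x))"
    by (intro sum_mono term_le)
  also have "\<dots> = (\<Sum>(s, t)\<in>(\<lambda>x. (d x, e x)) ` X. w s * w t)"
    by (simp add: sum.reindex[OF inj])
  \<comment> \<open>The pairs that occur are enlarged to the whole rectangle, where the sum is a
    product.\<close>
  also have "\<dots> \<le> (\<Sum>(s, t)\<in>d ` X \<times> e ` X. w s * w t)"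
    using \<open>finite X\<close> w_nonneg by (intro sum_mono2) auto
  also have "\<dots> = sum w (d ` X) * sum w (e ` X)"
    by (simp add: sum_product sum.cartesian_product)
  also have "\<dots> \<le> ((1 / (1 - 1 / sqrt 2)) ^ card S)\<^sup>2"
    unfolding power2_eq_square using D E w_nonneg
    by (intro mult_mono sum_nonneg zero_le_power) auto
  finally show ?thesis .
qed

theorem theorem5:
  fixes k :: nat
  assumes "k \<ge> 1"
  shows "\<exists>C :: real. \<forall>(S :: nat set) (q :: nat \<Rightarrow> nat).
           finite S \<and> card S = k \<and> (\<forall>p\<in>S. prime p) \<and>
           strict_mono_on {1..} q \<and> (\<forall>n\<ge>1. q n \<in> prime_products S) \<longrightarrow>
           (\<forall>n\<ge>2. (\<Sum>m=1..n-1. real (gcd (q m) (q n)) / real (q n)) \<le> C)"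
proof (intro exI allI impI)
  fix S :: "nat set" and q :: "nat \<Rightarrow> nat" and n :: nat
  assume *: "finite S \<and> card S = k \<and> (\<forall>p\<in>S. prime p) \<and>
           strict_mono_on {1..} q \<and> (\<forall>n\<ge>1. q n \<in> prime_products S)"
    and "n \<ge> 2"
  then have mono: "strict_mono_on {1..} q" by blast
  have inj: "inj_on q {1..n-1}"
    using strict_mono_on_imp_inj_on[OF mono] by (rule inj_on_subset) auto
  have less: "q m < q n" if "m \<in> {1..n-1}" for m
    using strict_mono_onD[OF mono, of m n] that \<open>n \<ge> 2\<close> by auto
  \<comment> \<open>Injectivity of \<open>q\<close> turns the indexed sum into a sum over a set of
    values below \<open>q n\<close>.\<close>
  have "(\<Sum>m=1..n-1. real (gcd (q m) (q n)) / real (q n)) =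
        (\<Sum>x\<in>q ` {1..n-1}. real (gcd x (q n)) / real (q n))"
    by (subst sum.reindex[OF inj]) simp
  also have "\<dots> \<le> ((1 / (1 - 1 / sqrt 2)) ^ card S)\<^sup>2"
    using * \<open>n \<ge> 2\<close> less by (intro sum_gcd_prime_products_le) (auto intro: less_imp_le)
  \<comment> \<open>Unification fixes the witness for \<open>C\<close> here. It was introduced
    before \<open>S\<close>, \<open>q\<close> and \<open>n\<close>, so \<open>card S\<close> has to
    be replaced by \<open>k\<close>.\<close>
  finally show "(\<Sum>m=1..n-1. real (gcd (q m) (q n)) / real (q n)) \<le> ((1 / (1 - 1 / sqrt 2)) ^ k)\<^sup>2"
    using * by simp
qed

end
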